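(* Let $ABC$ be a triangle whose orthocenter $H$ lies inside $\triangle ABC$, and let the cevians through $H$ be $AD$, $BE$, $CF$, with $D$ on side $BC$, $E$ on side $CA$, $F$ on side $AB$. Let $r_1$ be the radius of the excircle of $\triangle ABD$ that touches side $BD$, $r_2$ the radius of the excircle of $\triangle ACD$ that touches side $DC$, $r_3$ the radius of the excircle of $\triangle BCE$ that touches side $CE$, $r_4$ the radius of the excircle of $\triangle BAE$ that touches side $EA$, $r_5$ the radius of the excircle of $\triangle CAF$ that touches side $AF$, and $r_6$ the radius of the excircle of $\triangle CBF$ that touches side $FB$. Then $$r_1r_3r_5=r_2r_4r_6.$$
   Context: A cevian through a point $P$ inside a triangle is the segment from a vertex through $P$ to the opposite side. The excircle of a triangle that touches a given side is the circle tangent to that side (segment) and to the extensions of the other two sides, lying on the opposite side of that segment from the remaining vertex. *)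

theory Defs
  imports "HOL-Analysis.Analysis"
begin

definition is_orthocenter :: "real^2 \<Rightarrow> real^2 \<Rightarrow> real^2 \<Rightarrow> real^2 \<Rightarrow> bool" where
  "is_orthocenter H A B C \<longleftrightarrow>
     (H - A) \<bullet> (C - B) = 0 \<and> (H - B) \<bullet> (A - C) = 0 \<and> (H - C) \<bullet> (B - A) = 0"

text \<open>\<open>D\<close> is the endpoint on the side \<open>BC\<close> of the cevian from \<open>A\<close> through \<open>P\<close>.\<close>

definition is_cevian_foot :: "real^2 \<Rightarrow> real^2 \<Rightarrow> real^2 \<Rightarrow> real^2 \<Rightarrow> real^2 \<Rightarrow> bool" where
  "is_cevian_foot D P A B C \<longleftrightarrow> D \<in> closed_segment B C \<and> P \<in> closed_segment A D"

definition tangent_at :: "real^2 \<Rightarrow> real \<Rightarrow> real^2 \<Rightarrow> real^2 \<Rightarrow> real^2 \<Rightarrow> bool" where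
  "tangent_at J r P Q T \<longleftrightarrow> r > 0 \<and> P \<noteq> Q \<and> sphere J r \<inter> affine hull {P, Q} = {T}"

text \<open>The circle with centre \<open>J\<close> and radius \<open>r\<close> is the excircle of the triangle \<open>PQR\<close> that
  touches the side \<open>QR\<close>: it touches the segment \<open>QR\<close> and the extensions of \<open>PQ\<close> beyond \<open>Q\<close>
  and of \<open>PR\<close> beyond \<open>R\<close>, and the line \<open>QR\<close> separates every point of the circle from \<open>P\<close>.
  The points of tangency \<open>T\<close>, \<open>U\<close>, \<open>V\<close> are determined by the circle.\<close>

definition is_excircle ::
    "real^2 \<Rightarrow> real^2 \<Rightarrow> real^2 \<Rightarrow> real^2 \<Rightarrow> real \<Rightarrow> bool" where
  "is_excircle P Q R J r \<longleftrightarrow>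
     \<not> collinear {P, Q, R} \<and>
     (\<exists>T. tangent_at J r Q R T \<and> T \<in> closed_segment Q R) \<and>
     (\<exists>U. tangent_at J r P Q U \<and> Q \<in> open_segment P U) \<and>
     (\<exists>V. tangent_at J r P R V \<and> R \<in> open_segment P V) \<and>
     (\<forall>X \<in> sphere J r. closed_segment P X \<inter> affine hull {Q, R} \<noteq> {})"

end

theory Submission imports Defs begin

text \<open>In a right triangle with hypotenuse \<open>PQ\<close> and right angle at \<open>R\<close>, the excircle touching
  \<open>QR\<close> has radius \<open>(PQ + QR - PR) / 2\<close>, because the centre, \<open>R\<close> and the two tangency points near
  \<open>R\<close> form a square. The right triangles \<open>ABD\<close> and \<open>CBF\<close> share the angle at \<open>B\<close>, so they are similar
  and \<open>r1 / r6 = AB / BC\<close>. In the same way \<open>r3 / r2 = BC / CA\<close> and \<open>r5 / r4 = CA / AB\<close>, and the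
  product of the three ratios is \<open>1\<close>.\<close>

text \<open>Tangency means exactly one common point. If the radius to \<open>T\<close> were not
  perpendicular to the line, reflecting \<open>T\<close> in the foot of the perpendicular from
  \<open>J\<close> would give another common point.\<close>

lemma tangent_at_orthogonal:
  assumes "tangent_at J r P Q T"
  shows "(T - J) \<bullet> (Q - P) = 0"
proof -
  define d where "d = Q - P"
  have d: "d \<noteq> 0" and T: "sphere J r \<inter> affine hull {P, Q} = {T}"
    using assms by (auto simp: tangent_at_def d_def)
  \<comment> \<open>This is the other root, besides 0, of the quadratic |T - k d - J| = |T - J| in
    k; the two roots coincide exactly when the radius is perpendicular to the line.\<close>
  define k where "k = 2 * ((T - J) \<bullet> d) / (d \<bullet> d)"
  \<comment> \<open>the second intersection of the line with the circle\<close>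
  define T' where "T' = T - k *\<^sub>R d"
  have kd: "k * (d \<bullet> d) = 2 * ((T - J) \<bullet> d)"
    using d by (simp add: k_def)
  have "(T' - J) \<bullet> (T' - J) = (T - J) \<bullet> (T - J) + k * (k * (d \<bullet> d) - 2 * ((T - J) \<bullet> d))"
    by (simp add: T'_def inner_diff inner_commute algebra_simps)
  then have "norm (T' - J) = norm (T - J)"
    by (simp add: kd norm_eq_sqrt_inner)
  then have "dist J T' = dist J T"
    by (simp add: dist_norm norm_minus_commute[of J])
  then have "T' \<in> sphere J r"
    using T by auto
  moreover have "T' \<in> affine hull {P, Q}"
  proof -
    have "T \<in> affine hull {P, Q}"
      using T by blast
    then obtain u v where uv: "T = u *\<^sub>R P + v *\<^sub>R Q" "u + v = 1"
      by (auto simp: affine_hull_2)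
    then have "T' = (u + k) *\<^sub>R P + (v - k) *\<^sub>R Q"
      by (simp add: T'_def d_def algebra_simps)
    then show ?thesis
      using uv(2) unfolding affine_hull_2
      by (intro CollectI exI[of _ "u + k"] exI[of _ "v - k"]) auto
  qed
  ultimately have "T' = T"
    using T by blast
  then have "k = 0"
    using d by (simp add: T'_def)
  then show ?thesis
    using kd by (simp add: d_def)
qed

text \<open>Pythagoras in the triangle \<open>X T J\<close>, with its right angle at
  \<open>T\<close>. The right-hand side, the power of \<open>X\<close>, does not depend on the line,
  so the two tangent segments from a point are equal.\<close>

lemma tangent_at_length:
  assumes "tangent_at J r P Q T" and X: "X \<in> affine hull {P, Q}"
  shows "(dist X T)\<^sup>2 = (dist X J)\<^sup>2 - r\<^sup>2"
proof -
  have o: "(T - J) \<bullet> (Q - P) = 0"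
    by (rule tangent_at_orthogonal[OF assms(1)])
  have T: "T \<in> affine hull {P, Q}" "dist J T = r"
    using assms(1) unfolding tangent_at_def by (metis IntE insertI1 mem_sphere)+
  obtain u v where uv: "T = u *\<^sub>R P + v *\<^sub>R Q" "u + v = 1"
    using T by (auto simp: affine_hull_2)
  obtain u' v' where uv': "X = u' *\<^sub>R P + v' *\<^sub>R Q" "u' + v' = 1"
    using X by (auto simp: affine_hull_2)
  have "X - T = (v' - v) *\<^sub>R (Q - P)"
  proof -
    have u: "u = 1 - v" "u' = 1 - v'"
      using uv uv' by auto
    show ?thesis
      unfolding uv(1) uv'(1) u by (simp add: algebra_simps)
  qed
  then have "(T - J) \<bullet> (X - T) = 0"
    using o by simp
  then have "(X - J) \<bullet> (X - J) = (X - T) \<bullet> (X - T) + (T - J) \<bullet> (T - J)"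
    by (simp add: inner_diff inner_commute algebra_simps)
  then show ?thesis
    using T(2) by (simp add: dist_norm power2_norm_eq_inner norm_minus_commute[of J] flip: T(2))
qed

lemma tangent_at_length_eq:
  assumes "tangent_at J r P Q T" "X \<in> affine hull {P, Q}"
    and "tangent_at J r P' Q' T'" "X \<in> affine hull {P', Q'}"
  shows "dist X T = dist X T'"
  using tangent_at_length[OF assms(1,2)] tangent_at_length[OF assms(3,4)]
  by (metis power2_eq_iff_nonneg zero_le_dist)

text \<open>The determinant \<open>D\<close> of u and v is nonzero by the Gram identity, and
  Cramer's rule recovers the coordinates of w from its two inner products.\<close>

lemma orthogonal_pair_complete:
  fixes u v w :: "real^2"
  assumes "u \<bullet> v = 0" "u \<noteq> 0" "v \<noteq> 0" "w \<bullet> u = 0" "w \<bullet> v = 0"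
  shows "w = 0"
proof -
  define D where "D = u$1 * v$2 - u$2 * v$1"
  have "D\<^sup>2 = (u \<bullet> u) * (v \<bullet> v) - (u \<bullet> v)\<^sup>2"
    by (simp add: D_def inner_vec_def sum_2 power2_eq_square algebra_simps)
  then have "D \<noteq> 0"
    using assms by auto
  have "w$1 * D = v$2 * (w \<bullet> u) - u$2 * (w \<bullet> v)"
    by (simp add: D_def inner_vec_def sum_2 algebra_simps)
  moreover have "w$2 * D = u$1 * (w \<bullet> v) - v$1 * (w \<bullet> u)"
    by (simp add: D_def inner_vec_def sum_2 algebra_simps)
  ultimately show ?thesis
    using assms \<open>D \<noteq> 0\<close> by (simp add: vec_eq_iff forall_2)
qed

text \<open>Equal tangents from the vertices give PQ + QT = PR + RV and QR = QT + RV, which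
  determine RV. The right angle then makes \<open>R T J V\<close> a square, so RV is the
  radius.\<close>

lemma excircle_radius_right_triangle:
  assumes ex: "is_excircle P Q R J r" and right: "(Q - R) \<bullet> (P - R) = 0"
  shows "r = (dist P Q + dist Q R - dist P R) / 2"
proof -
  obtain T U V where T: "tangent_at J r Q R T" "T \<in> closed_segment Q R"
    and U: "tangent_at J r P Q U" "Q \<in> open_segment P U"
    and V: "tangent_at J r P R V" "R \<in> open_segment P V"
    using ex unfolding is_excircle_def by blast
  have ne: "Q \<noteq> R" "P \<noteq> R" and r: "r > 0"
    using T V by (auto simp: tangent_at_def)
  have hull: "X \<in> affine hull {X, Y}" "X \<in> affine hull {Y, X}" for X Y :: "real^2"
    by (simp_all add: hull_inc)
  have RT: "dist R T = dist R V" and QT: "dist Q T = dist Q U" and PU: "dist P U = dist P V"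
    by (rule tangent_at_length_eq[OF T(1) _ V(1)] tangent_at_length_eq[OF T(1) _ U(1)]
        tangent_at_length_eq[OF U(1) _ V(1)], simp_all add: hull)+
  have "dist Q R = dist Q T + dist R T"
    using T(2) by (simp add: between dist_commute flip: between_mem_segment)
  moreover have "dist P U = dist P Q + dist Q U"
    using U(2) by (simp add: open_segment_def between flip: between_mem_segment)
  moreover have "dist P V = dist P R + dist R V"
    using V(2) by (simp add: open_segment_def between flip: between_mem_segment)
  ultimately have len: "dist R V = (dist P Q + dist Q R - dist P R) / 2"
    using RT QT PU by simp
  obtain t where t: "T - R = t *\<^sub>R (Q - R)"
  proof -
    obtain u where "T = (1 - u) *\<^sub>R Q + u *\<^sub>R R"
      using T(2) by (auto simp: in_segment)
    then have "T - R = (1 - u) *\<^sub>R (Q - R)"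
      by (simp add: algebra_simps)
    then show ?thesis
      using that by blast
  qed
  have VPR: "V \<in> affine hull {P, R}"
    using V(1) by (auto simp: tangent_at_def)
  obtain v where v: "V - R = v *\<^sub>R (P - R)"
  proof -
    obtain a b where "V = a *\<^sub>R P + b *\<^sub>R R" "a + b = 1"
      using VPR by (auto simp: affine_hull_2)
    then have "V - R = a *\<^sub>R P + b *\<^sub>R R - (a + b) *\<^sub>R R"
      by simp
    then have "V - R = a *\<^sub>R (P - R)"
      by (simp add: algebra_simps)
    then show ?thesis
      using that by blast
  qed
  have JT: "(J - T) \<bullet> (Q - R) = 0" and JV: "(J - V) \<bullet> (P - R) = 0"
    using tangent_at_orthogonal[OF T(1)] tangent_at_orthogonal[OF V(1)]
    by (simp_all add: inner_diff algebra_simps)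
  \<comment> \<open>The square closes up: the defect of the parallelogram is orthogonal to both
    legs.\<close>
  have "(J - T) - (V - R) = 0"
  proof (rule orthogonal_pair_complete[OF right])
    show "((J - T) - (V - R)) \<bullet> (Q - R) = 0"
      using right by (simp add: inner_diff_left[of "J - T"] JT v inner_commute[of "P - R"])
    \<comment> \<open>In this form both terms are visibly orthogonal to \<open>P - R\<close>: one is
      a radius to that line, the other lies along the other leg.\<close>
    have swap: "(J - T) - (V - R) = (J - V) - (T - R)"
      by simp
    show "((J - T) - (V - R)) \<bullet> (P - R) = 0"
      using right unfolding swap by (simp add: inner_diff_left[of "J - V"] JV t)
  qed (use ne in auto)
  then have "dist R V = dist J T"
    by (simp add: dist_norm norm_minus_commute)
  also have "\<dots> = r"
    using T(1) unfolding tangent_at_def by (metis IntE insertI1 mem_sphere)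
  finally show ?thesis
    using len by simp
qed

text \<open>\<open>H - A\<close> is a multiple of \<open>D - A\<close>. The factor is nonzero
  because the vertex \<open>A\<close> is an extreme point of the triangle and so cannot be the
  interior point \<open>H\<close>.\<close>

lemma is_cevian_foot_orthogonal:
  assumes nc: "\<not> collinear {A, B, C}"
    and H: "(H - A) \<bullet> (C - B) = 0" "H \<in> interior (convex hull {A, B, C})"
    and foot: "is_cevian_foot D H A B C"
  shows "(D - A) \<bullet> (C - B) = 0"
proof -
  have "\<not> affine_dependent {A, B, C}"
    using nc affine_dependent_imp_collinear_3 by blast
  then have "A extreme_point_of (convex hull {A, B, C})"
    by (simp add: extreme_point_of_convex_hull_affine_independent)
  then have "H \<noteq> A"
    using H(2) extreme_point_not_in_interior by blast
  obtain t where t: "H = (1 - t) *\<^sub>R A + t *\<^sub>R D"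
    using foot by (auto simp: is_cevian_foot_def in_segment)
  then have eq: "H - A = t *\<^sub>R (D - A)"
    by (simp add: algebra_simps)
  with \<open>H \<noteq> A\<close> have "t \<noteq> 0"
    by auto
  then show ?thesis
    using H(1) by (simp add: eq)
qed

text \<open>The right-hand sides of the two product formulas are symmetric in \<open>A\<close> and
  \<open>C\<close>, so they take the same values for the altitude from \<open>C\<close>. The second
  one is four times the squared area of \<open>A B C\<close>.\<close>

lemma altitude_foot_products:
  assumes D: "D \<in> closed_segment B C" and orth: "(D - A) \<bullet> (C - B) = 0"
  shows "dist B D * dist B C = (A - B) \<bullet> (C - B)"
    and "(B - D) \<bullet> (A - D) = 0"
    and "(dist A D * dist B C)\<^sup>2 = (dist A B * dist B C)\<^sup>2 - ((A - B) \<bullet> (C - B))\<^sup>2"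
proof -
  obtain s where s: "0 \<le> s" "D = (1 - s) *\<^sub>R B + s *\<^sub>R C"
    using D by (auto simp: in_segment)
  then have DB: "D - B = s *\<^sub>R (C - B)"
    by (simp add: algebra_simps)
  have BD: "dist B D = s * dist B C"
    using s(1) by (simp add: dist_norm norm_minus_commute[of B] DB)
  have "(A - B) \<bullet> (C - B) = (D - B) \<bullet> (C - B)"
    using orth by (simp add: inner_diff_left)
  also have "\<dots> = s * (dist B C)\<^sup>2"
    by (simp add: DB dist_norm norm_minus_commute[of B] power2_norm_eq_inner)
  finally show prod: "dist B D * dist B C = (A - B) \<bullet> (C - B)"
    by (simp add: BD power2_eq_square)
  have "B - D = - s *\<^sub>R (C - B)"
    using DB by (metis minus_diff_eq scaleR_minus_left)
  moreover have "(C - B) \<bullet> (A - D) = 0"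
    using orth by (simp add: inner_diff inner_commute algebra_simps)
  ultimately show right: "(B - D) \<bullet> (A - D) = 0"
    by simp
  have "(A - B) \<bullet> (A - B) = (A - D) \<bullet> (A - D) + (B - D) \<bullet> (B - D) - 2 * ((B - D) \<bullet> (A - D))"
    by (simp add: inner_diff inner_commute algebra_simps)
  then have "(dist A B)\<^sup>2 = (dist A D)\<^sup>2 + (dist B D)\<^sup>2"
    by (simp add: right dist_norm power2_norm_eq_inner)
  then show "(dist A D * dist B C)\<^sup>2 = (dist A B * dist B C)\<^sup>2 - ((A - B) \<bullet> (C - B))\<^sup>2"
    unfolding prod[symmetric] by (simp add: power_mult_distrib distrib_right)
qed

text \<open>This is the similarity at \<open>B\<close> with denominators cleared: in 2 r BC = (AB +
  BD - AD) BC each product equals the matching one in 2 r' AB = (CB + BF - CF) AB.\<close>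

lemma excircle_radii_common_angle:
  assumes D: "D \<in> closed_segment B C" "(D - A) \<bullet> (C - B) = 0" "is_excircle A B D J r"
    and F: "F \<in> closed_segment B A" "(F - C) \<bullet> (A - B) = 0" "is_excircle C B F J' r'"
  shows "r * dist B C = r' * dist A B"
proof -
  note d = altitude_foot_products[OF D(1,2)]
  note f = altitude_foot_products[OF F(1,2)]
  have "(dist A D * dist B C)\<^sup>2 = (dist C F * dist B A)\<^sup>2"
    unfolding d(3) f(3) by (simp add: inner_commute dist_commute mult.commute)
  then have "dist A D * dist B C = dist C F * dist B A"
    by (simp add: power2_eq_iff_nonneg)
  moreover have "dist B D * dist B C = dist B F * dist B A"
    by (simp add: d(1) f(1) inner_commute)
  ultimately show ?thesis
    unfolding excircle_radius_right_triangle[OF D(3) d(2)]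
      excircle_radius_right_triangle[OF F(3) f(2)]
    by (simp add: dist_commute ring_distribs diff_divide_distrib add_divide_distrib mult.commute)
qed

theorem theorem2p1:
  fixes A B C H D E F J1 J2 J3 J4 J5 J6 :: "real^2"
    and r1 r2 r3 r4 r5 r6 :: real
  assumes "\<not> collinear {A, B, C}"
    and "is_orthocenter H A B C"
    and "H \<in> interior (convex hull {A, B, C})"
    and "is_cevian_foot D H A B C"
    and "is_cevian_foot E H B C A"
    and "is_cevian_foot F H C A B"
    and "is_excircle A B D J1 r1"
    and "is_excircle A C D J2 r2"
    and "is_excircle B C E J3 r3"
    and "is_excircle B A E J4 r4"
    and "is_excircle C A F J5 r5"
    and "is_excircle C B F J6 r6"
  shows "r1 * r3 * r5 = r2 * r4 * r6"
proof -
  have perm: "{B, C, A} = {A, B, C}" "{C, A, B} = {A, B, C}"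
    by auto
  have H: "(H - A) \<bullet> (C - B) = 0" "(H - B) \<bullet> (A - C) = 0" "(H - C) \<bullet> (B - A) = 0"
    using assms(2) by (auto simp: is_orthocenter_def)
  have orth: "(D - A) \<bullet> (C - B) = 0" "(E - B) \<bullet> (A - C) = 0" "(F - C) \<bullet> (B - A) = 0"
    using is_cevian_foot_orthogonal[OF assms(1) H(1) assms(3,4)]
      is_cevian_foot_orthogonal[of B C A H E] is_cevian_foot_orthogonal[of C A B H F]
      assms(1,3,5,6) H(2,3) by (simp_all add: perm)
  have orth': "(D - A) \<bullet> (B - C) = 0" "(E - B) \<bullet> (C - A) = 0" "(F - C) \<bullet> (A - B) = 0"
    using orth by (simp_all add: inner_diff_right)
  have seg: "D \<in> closed_segment B C" "E \<in> closed_segment C A" "F \<in> closed_segment A B"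
    using assms(4-6) by (auto simp: is_cevian_foot_def)
  then have seg': "D \<in> closed_segment C B" "E \<in> closed_segment A C" "F \<in> closed_segment B A"
    by (simp_all add: closed_segment_commute)
  \<comment> \<open>The three instances are the pairs of right triangles sharing the angle at
    \<open>B\<close>, \<open>C\<close> and \<open>A\<close>, in that order.\<close>
  have "r1 * dist B C = r6 * dist A B"
    by (rule excircle_radii_common_angle[OF seg(1) orth(1) assms(7) seg'(3) orth'(3) assms(12)])
  moreover have "r3 * dist C A = r2 * dist B C"
    by (rule excircle_radii_common_angle[OF seg(2) orth(2) assms(9) seg'(1) orth'(1) assms(8)])
  moreover have "r5 * dist A B = r4 * dist C A"
    by (rule excircle_radii_common_angle[OF seg(3) orth(3) assms(11) seg'(2) orth'(2) assms(10)])
  ultimately have "(r1 * dist B C) * (r3 * dist C A) * (r5 * dist A B)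
      = (r6 * dist A B) * (r2 * dist B C) * (r4 * dist C A)"
    by simp
  then have "(r1 * r3 * r5) * (dist A B * dist B C * dist C A)
      = (r2 * r4 * r6) * (dist A B * dist B C * dist C A)"
    by (simp only: mult_ac)
  \<comment> \<open>Distinct vertices make the common factor, the product of the sides, nonzero, so
    it cancels.\<close>
  moreover have "A \<noteq> B" "B \<noteq> C" "C \<noteq> A"
    using assms(1) by (auto simp: insert_commute)
  ultimately show ?thesis
    by simp
qed

end
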